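(* Let $X_k$ ($k\ge 2$) denote the Tarbard space, with its strictly singular operator $S\in\mathcal S(X_k)$, as described in the context. (i) The algebras $\mathcal L(X_2)$ and $\mathcal L(X_3)$ do not have any non-trivial closed subideals. (ii) Let $k\ge 4$ and fix $j\in\mathbb N$ such that $k/2\le j\le k-2$. Then the family $\mathfrak F_j$ consisting of the non-trivial closed $[S^j]$-subideals of $\mathcal L(X_k)$ equals the class of closed subalgebras $$\mathcal I_N := N+\mathcal K(X_k),$$ where $\{0\}\ne N\subset \mathrm{span}(S^j,\ldots,S^{k-1})$ is any linear subspace that satisfies $$N\neq \mathrm{span}(S^r,\ldots,S^{k-1})\quad\text{for } r=j,\ldots,k-1.$$ Each family $\mathfrak F_j$ has the size of the continuum.
   Context: For a Banach space $X$, $\mathcal L(X)$ is the Banach algebra of bounded linear operators on $X$, $\mathcal K(X)$ the compact operators and $\mathcal S(X)$ the strictly singular operators (operators whose restriction to any closed infinite-dimensional subspace is not a linear isomorphism onto its image). Subideals: Let $\mathcal A$ be a Banach algebra and $\mathcal J\subset\mathcal I\subset\mathcal A$ closed subalgebras. $\mathcal J$ is a closed $\mathcal I$-subideal of $\mathcal A$ if $\mathcal I$ is a (two-sided) ideal of $\mathcal A$ and $\mathcal J$ is an ideal of $\mathcal I$. It is non-trivial if $\mathcal J$ is not an ideal of $\mathcal A$. $\mathcal J$ is a non-trivial closed subideal of $\mathcal A$ if it is a non-trivial closed $\mathcal I$-subideal for some closed ideal $\mathcal I\subsetneq\mathcal A$. Tarbard spaces: for each $k\ge 2$, the Tarbard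 space $X_k$ is a separable real hereditarily indecomposable $\mathcal L^\infty$-space with a Schauder basis, with $X_k^*\approx\ell^1$, constructed by M. Tarbard, which has the following (known) properties. (a) There is a strictly singular operator $S\in\mathcal S(X_k)\setminus\mathcal K(X_k)$ such that $S^{k-1}\notin\mathcal K(X_k)$, $S^k=0$, and every $U\in\mathcal L(X_k)$ has a unique representation $U=\alpha I_{X_k}+\sum_{j=1}^{k-1}\alpha_jS^j+T$ with $\alpha,\alpha_1,\ldots,\alpha_{k-1}\in\mathbb R$ and $T\in\mathcal K(X_k)$. (b) The non-zero closed ideals of $\mathcal L(X_k)$ form the chain $$\mathcal K(X_k)\subsetneq[S^{k-1}]\subsetneq[S^{k-2}]\subsetneq\cdots\subsetneq[S^2]\subsetneq[S]=\mathcal S(X_k)\subsetneq\mathcal L(X_k),$$ where $[S^j]$ denotes the closed ideal of $\mathcal L(X_k)$ generated by $S^j$ and $[S^j]=\mathrm{span}(S^j,\ldots,S^{k-1})+\mathcal K(X_k)$ for $j=1,\ldots,k-1$. *)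

theory Defs
  imports "HOL-Analysis.Analysis" "HOL-Library.Set_Algebras" "HOL-Library.Equipollence"
begin

section \<open>Closed ideals and subideals of Banach algebras\<close>

text \<open>
  The multiplication is a parameter rather than a type-class operation, so that the operators
  \<open>'a \<Rightarrow>\<^sub>L 'a\<close> under composition are an instance.  The whole algebra is the universe of the type;
  no unit is required.
\<close>

locale banach_algebra =
  fixes mult :: "'b::banach \<Rightarrow> 'b \<Rightarrow> 'b"  (infixl \<open>\<odot>\<close> 70)
  assumes mult_assoc: "(x \<odot> y) \<odot> z = x \<odot> (y \<odot> z)"
    and bounded_bilinear_mult: "bounded_bilinear (\<odot>)"
    and norm_mult_le: "norm (x \<odot> y) \<le> norm x * norm y"
begin

definition closed_subalgebra :: "'b set \<Rightarrow> bool" where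
  "closed_subalgebra B \<longleftrightarrow> subspace B \<and> closed B \<and> (\<forall>x\<in>B. \<forall>y\<in>B. x \<odot> y \<in> B)"

definition ideal_of :: "'b set \<Rightarrow> 'b set \<Rightarrow> bool" where
  "ideal_of J B \<longleftrightarrow> J \<subseteq> B \<and> subspace J \<and> (\<forall>a\<in>B. \<forall>x\<in>J. a \<odot> x \<in> J \<and> x \<odot> a \<in> J)"

definition closed_ideal :: "'b set \<Rightarrow> bool" where
  "closed_ideal I \<longleftrightarrow> closed I \<and> ideal_of I UNIV"

definition generated_closed_ideal :: "'b \<Rightarrow> 'b set" where
  "generated_closed_ideal x = \<Inter>{I. closed_ideal I \<and> x \<in> I}"

definition closed_subideal_in :: "'b set \<Rightarrow> 'b set \<Rightarrow> bool" where
  "closed_subideal_in I J \<longleftrightarrow>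
     closed_subalgebra J \<and> closed_subalgebra I \<and> ideal_of I UNIV \<and> ideal_of J I"

definition nontrivial_closed_subideal_in :: "'b set \<Rightarrow> 'b set \<Rightarrow> bool" where
  "nontrivial_closed_subideal_in I J \<longleftrightarrow> closed_subideal_in I J \<and> \<not> ideal_of J UNIV"

definition nontrivial_closed_subideal :: "'b set \<Rightarrow> bool" where
  "nontrivial_closed_subideal J \<longleftrightarrow>
     (\<exists>I. closed_ideal I \<and> I \<noteq> UNIV \<and> nontrivial_closed_subideal_in I J)"

end

interpretation op_alg: banach_algebra "(o\<^sub>L) :: ('a::banach \<Rightarrow>\<^sub>L 'a) \<Rightarrow> ('a \<Rightarrow>\<^sub>L 'a) \<Rightarrow> ('a \<Rightarrow>\<^sub>L 'a)"
proof (rule banach_algebra.intro)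
  show "(x o\<^sub>L y) o\<^sub>L z = x o\<^sub>L (y o\<^sub>L z)" for x y z :: "'a \<Rightarrow>\<^sub>L 'a"
    by (rule blinfun_eqI) simp
  show "bounded_bilinear ((o\<^sub>L) :: ('a \<Rightarrow>\<^sub>L 'a) \<Rightarrow> _)"
    by (rule bounded_bilinear_blinfun_compose)
  show "norm (x o\<^sub>L y) \<le> norm x * norm y" for x y :: "'a \<Rightarrow>\<^sub>L 'a"
    by (rule norm_blinfun_compose)
qed

section \<open>Classes of operators\<close>

definition compact_operator :: "('a::real_normed_vector \<Rightarrow>\<^sub>L 'b::real_normed_vector) \<Rightarrow> bool" where
  "compact_operator T \<longleftrightarrow> compact (closure (blinfun_apply T ` cball 0 1))"

definition infinite_dimensional :: "'a::real_vector set \<Rightarrow> bool" where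
  "infinite_dimensional M \<longleftrightarrow> \<not> (\<exists>B. finite B \<and> M \<subseteq> span B)"

text \<open>
  A linear isomorphism onto the image means a linear homeomorphism onto the image;
  linearity of the restriction and of its inverse is automatic.
\<close>

definition strictly_singular :: "('a::real_normed_vector \<Rightarrow>\<^sub>L 'b::real_normed_vector) \<Rightarrow> bool" where
  "strictly_singular T \<longleftrightarrow>
     (\<forall>M. subspace M \<and> closed M \<and> infinite_dimensional M \<longrightarrow>
        \<not> (\<exists>g. homeomorphism M (blinfun_apply T ` M) (blinfun_apply T) g))"

definition compact_ops :: "('a::banach \<Rightarrow>\<^sub>L 'a) set"  (\<open>\<K>\<close>) where
  "\<K> = {T. compact_operator T}"

definition strictly_singular_ops :: "('a::banach \<Rightarrow>\<^sub>L 'a) set"  (\<open>\<S>\<close>) where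
  "\<S> = {T. strictly_singular T}"

primrec op_pow :: "('a::real_normed_vector \<Rightarrow>\<^sub>L 'a) \<Rightarrow> nat \<Rightarrow> ('a \<Rightarrow>\<^sub>L 'a)"  (infixr \<open>^\<^sub>L\<close> 80) where
  "T ^\<^sub>L 0 = id_blinfun"
| "T ^\<^sub>L Suc n = T o\<^sub>L (T ^\<^sub>L n)"

definition power_span :: "('a::real_normed_vector \<Rightarrow>\<^sub>L 'a) \<Rightarrow> nat \<Rightarrow> nat \<Rightarrow> ('a \<Rightarrow>\<^sub>L 'a) set" where
  "power_span S j k = span ((\<lambda>i. S ^\<^sub>L i) ` {j..k - 1})"

section \<open>Classes of Banach spaces\<close>

definition hereditarily_indecomposable :: "'a::banach itself \<Rightarrow> bool" where
  "hereditarily_indecomposable _ \<longleftrightarrow>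
     infinite_dimensional (UNIV :: 'a set) \<and>
     \<not> (\<exists>M N :: 'a set.
          subspace M \<and> closed M \<and> infinite_dimensional M \<and>
          subspace N \<and> closed N \<and> infinite_dimensional N \<and>
          M \<inter> N = {0} \<and> closed (M + N))"

text \<open>
  Every finite-dimensional subspace is contained in a subspace \<open>F\<close> whose Banach--Mazur distance
  to the \<open>n\<close>-dimensional supremum-norm space is at most \<open>C\<close>.  Here \<open>F\<close> is the span of
  the images \<open>b 0, \<dots>, b (n - 1)\<close> of the unit vectors under an isomorphism, scaled so that its
  inverse has norm at most one.
\<close>

definition script_L_infinity_space :: "'a::banach itself \<Rightarrow> bool" where
  "script_L_infinity_space _ \<longleftrightarrow>
     (\<exists>C::real\<ge>1. \<forall>A :: 'a set. finite A \<longrightarrow>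
        (\<exists>n>0. \<exists>b :: nat \<Rightarrow> 'a. span A \<subseteq> span (b ` {..<n}) \<and>
           (\<forall>c :: nat \<Rightarrow> real.
              (MAX i\<in>{..<n}. \<bar>c i\<bar>) \<le> norm (\<Sum>i<n. c i *\<^sub>R b i) \<and>
              norm (\<Sum>i<n. c i *\<^sub>R b i) \<le> C * (MAX i\<in>{..<n}. \<bar>c i\<bar>))))"

definition schauder_basis :: "(nat \<Rightarrow> 'a::banach) \<Rightarrow> bool" where
  "schauder_basis e \<longleftrightarrow> (\<forall>x. \<exists>!c :: nat \<Rightarrow> real. (\<lambda>n. c n *\<^sub>R e n) sums x)"

definition l1_sequences :: "(nat \<Rightarrow> real) set" where
  "l1_sequences = {a. summable (\<lambda>n. \<bar>a n\<bar>)}"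

definition dual_isomorphic_l1 :: "'a::banach itself \<Rightarrow> bool" where
  "dual_isomorphic_l1 _ \<longleftrightarrow>
     (\<exists>\<Phi> :: (nat \<Rightarrow> real) \<Rightarrow> ('a \<Rightarrow>\<^sub>L real).
        bij_betw \<Phi> l1_sequences UNIV \<and>
        (\<forall>a\<in>l1_sequences. \<forall>b\<in>l1_sequences. \<Phi> (\<lambda>n. a n + b n) = \<Phi> a + \<Phi> b) \<and>
        (\<forall>a\<in>l1_sequences. \<forall>r. \<Phi> (\<lambda>n. r * a n) = r *\<^sub>R \<Phi> a) \<and>
        (\<exists>c>0. \<exists>C>0. \<forall>a\<in>l1_sequences.
           c * (\<Sum>n. \<bar>a n\<bar>) \<le> norm (\<Phi> a) \<and> norm (\<Phi> a) \<le> C * (\<Sum>n. \<bar>a n\<bar>)))"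

section \<open>Tarbard spaces\<close>

text \<open>
  The Bourgain--Delbaen type construction of these spaces is not carried out here: the space
  \<open>X\<^sub>k\<close> and its distinguished operator \<open>S\<close> enter through the properties established by Tarbard,
  for an arbitrary Banach space \<open>'a\<close> and operator \<open>S\<close> having them.
\<close>

definition tarbard_representation :: "nat \<Rightarrow> ('a::banach \<Rightarrow>\<^sub>L 'a) \<Rightarrow> bool" where
  "tarbard_representation k S \<longleftrightarrow>
     S \<in> \<S> - \<K> \<and> S ^\<^sub>L (k - 1) \<notin> \<K> \<and> S ^\<^sub>L k = 0 \<and>
     (\<forall>U. \<exists>!p. case p of (\<alpha> :: real, a :: nat \<Rightarrow> real, T) \<Rightarrow>
        (\<forall>j. j \<notin> {1..k - 1} \<longrightarrow> a j = 0) \<and> T \<in> \<K> \<and>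
        U = \<alpha> *\<^sub>R id_blinfun + (\<Sum>j = 1..k - 1. a j *\<^sub>R (S ^\<^sub>L j)) + T)"

definition tarbard_ideal_chain :: "nat \<Rightarrow> ('a::banach \<Rightarrow>\<^sub>L 'a) \<Rightarrow> bool" where
  "tarbard_ideal_chain k S \<longleftrightarrow>
     {I. op_alg.closed_ideal I \<and> I \<noteq> {0}} =
       {\<K>} \<union> (\<lambda>j. op_alg.generated_closed_ideal (S ^\<^sub>L j)) ` {1..k - 1} \<union> {UNIV} \<and>
     \<K> \<subset> op_alg.generated_closed_ideal (S ^\<^sub>L (k - 1)) \<and>
     (\<forall>j\<in>{1..<k - 1}. op_alg.generated_closed_ideal (S ^\<^sub>L (j + 1))
                        \<subset> op_alg.generated_closed_ideal (S ^\<^sub>L j)) \<and>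
     op_alg.generated_closed_ideal S = \<S> \<and>
     \<S> \<subset> (UNIV :: ('a \<Rightarrow>\<^sub>L 'a) set) \<and>
     (\<forall>j\<in>{1..k - 1}. op_alg.generated_closed_ideal (S ^\<^sub>L j) = power_span S j k + \<K>)"

definition tarbard_space :: "nat \<Rightarrow> ('a::banach \<Rightarrow>\<^sub>L 'a) \<Rightarrow> bool" where
  "tarbard_space k S \<longleftrightarrow>
     k \<ge> 2 \<and>
     separable_space (euclidean :: 'a topology) \<and>
     hereditarily_indecomposable TYPE('a) \<and>
     script_L_infinity_space TYPE('a) \<and>
     (\<exists>e :: nat \<Rightarrow> 'a. schauder_basis e) \<and>
     dual_isomorphic_l1 TYPE('a) \<and>
     tarbard_representation k S \<and>
     tarbard_ideal_chain k S"

end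

theory Submission
  imports Defs
begin

text \<open>
  Two facts reduce everything to linear algebra in the finite-dimensional quotient
  \<open>\<S> / \<K>\<close>, which has the basis \<open>S, \<dots>, S\<^bsup>k-1\<^esup>\<close>.

  First, every non-zero closed subideal \<open>J\<close> contains \<open>\<K>\<close>
  (\<open>compact_subset_subideal\<close>).  If \<open>0 \<noteq> u \<in> J\<close>, some product \<open>c u d\<close> with compact \<open>c\<close>, \<open>d\<close> is
  non-zero, and all its two-sided multiples stay in \<open>J\<close> because the outer factors are absorbed
  by \<open>c\<close> and \<open>d\<close>.  Hence the largest ideal of the whole algebra inside \<open>J\<close> is closed and
  non-zero, and \<open>\<K>\<close> is the smallest such ideal.  This replaces the usual density of the
  finite-rank operators in \<open>\<K>\<close>.  It follows that a closed subideal in \<open>[S\<^sup>j]\<close> is \<open>N + \<K>\<close> for the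
  subspace \<open>N\<close> of those elements of \<open>span (S\<^sup>j, \<dots>, S\<^bsup>k-1\<^esup>)\<close> that it contains
  (\<open>subideal_decomposition\<close>), and \<open>N\<close> is unique since this span meets \<open>\<K>\<close> only in \<open>0\<close>.

  Second, for \<open>k \<le> 2 j\<close> the relation \<open>S\<^sup>k = 0\<close> makes every product of two elements of \<open>[S\<^sup>j]\<close>
  compact (\<open>generated_products_compact\<close>).  So every \<open>N + \<K>\<close> is an ideal of \<open>[S\<^sup>j]\<close>; it is closed
  as the sum of a closed and a finite-dimensional subspace.  By the list of closed ideals and the
  uniqueness of \<open>N\<close>, it is an ideal of the whole algebra exactly if \<open>N = 0\<close> or \<open>N\<close> is one of the
  spans of \<open>S\<^sup>r, \<dots>, S\<^bsup>k-1\<^esup>\<close>.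

  For \<open>k = 2\<close> and \<open>k = 3\<close> there is no room.  The ideal \<open>[S\<^bsup>k-1\<^esup>]\<close> is one-dimensional modulo \<open>\<K>\<close>.
  If \<open>k = 3\<close> and a subideal in \<open>[S]\<close> has an element with non-zero coefficient at \<open>S\<close>, then
  multiplication by \<open>S\<close> yields \<open>S\<^sup>2\<close>, whence \<open>S\<close>, so that the subideal is all of \<open>[S]\<close>.

  The number of subideals is at most the number of subspaces of a finite-dimensional real space,
  hence at most the continuum; the lines spanned by \<open>S\<^bsup>k-2\<^esup> + t S\<^bsup>k-1\<^esup>\<close> for real \<open>t\<close> give that many.
\<close>

section \<open>Minimal closed ideals\<close>

context banach_algebra
begin

lemma closed_ideal_generated: "closed_ideal (generated_closed_ideal x)"
  unfolding generated_closed_ideal_def closed_ideal_def ideal_of_def subspace_def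
  by (auto intro!: closed_Inter)

lemma generator_in_generated_closed_ideal: "x \<in> generated_closed_ideal x"
  unfolding generated_closed_ideal_def by auto

lemma generated_closed_ideal_subset:
  "\<lbrakk>closed_ideal I; x \<in> I\<rbrakk> \<Longrightarrow> generated_closed_ideal x \<subseteq> I"
  unfolding generated_closed_ideal_def by auto

lemma continuous_mult_left: "continuous_on UNIV (\<lambda>v. c \<odot> v)"
  by (rule linear_continuous_on[OF bounded_bilinear.bounded_linear_right[OF bounded_bilinear_mult]])

lemma continuous_mult_right: "continuous_on UNIV (\<lambda>v. v \<odot> c)"
  by (rule linear_continuous_on[OF bounded_bilinear.bounded_linear_left[OF bounded_bilinear_mult]])

lemmas mult_linear_simps =
  bounded_bilinear.add_left[OF bounded_bilinear_mult]
  bounded_bilinear.add_right[OF bounded_bilinear_mult]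
  bounded_bilinear.scaleR_left[OF bounded_bilinear_mult]
  bounded_bilinear.scaleR_right[OF bounded_bilinear_mult]
  bounded_bilinear.zero_left[OF bounded_bilinear_mult]
  bounded_bilinear.zero_right[OF bounded_bilinear_mult]

text \<open>
  The largest ideal of the whole algebra contained in a subspace \<open>J\<close>.  One-sided multiples are
  listed separately since the algebra need not have a unit.
\<close>

definition ideal_core :: "'b set \<Rightarrow> 'b set" where
  "ideal_core J = {v\<in>J. \<forall>c. c \<odot> v \<in> J \<and> v \<odot> c \<in> J \<and> (\<forall>d. (c \<odot> v) \<odot> d \<in> J)}"

lemma closed_ideal_ideal_core:
  assumes "closed J" "subspace J"
  shows "closed_ideal (ideal_core J)"
proof -
  have "ideal_core J = J \<inter> (\<Inter>c. (\<lambda>v. c \<odot> v) -` J) \<inter> (\<Inter>c. (\<lambda>v. v \<odot> c) -` J)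
      \<inter> (\<Inter>c. \<Inter>d. (\<lambda>v. (c \<odot> v) \<odot> d) -` J)"
    unfolding ideal_core_def by auto
  moreover have "continuous_on UNIV (\<lambda>v. (c \<odot> v) \<odot> d)" for c d
    using continuous_on_compose2[OF continuous_mult_right continuous_mult_left] by auto
  ultimately have "closed (ideal_core J)"
    using assms(1)
    by (auto intro!: closed_Int closed_INT closed_vimage continuous_mult_left continuous_mult_right)
  moreover have "ideal_of (ideal_core J) UNIV"
    using assms(2) unfolding ideal_of_def ideal_core_def subspace_def
    by (auto simp: mult_linear_simps mult_assoc) (metis mult_assoc)+
  ultimately show ?thesis unfolding closed_ideal_def by simp
qed

text \<open>
  The left and right annihilators of \<open>K\<close> are closed ideals.  If one of them were non-zero, it would
  contain \<open>K\<close> by minimality, so that all products in \<open>K\<close> would vanish.  Hence \<open>u\<close> survives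
  multiplication by \<open>K\<close> first on the right and then on the left.
\<close>

lemma nonzero_two_sided_product:
  assumes K: "closed_ideal K"
    and min: "\<And>I. \<lbrakk>closed_ideal I; I \<noteq> {0}\<rbrakk> \<Longrightarrow> K \<subseteq> I"
    and ab: "a \<in> K" "b \<in> K" "a \<odot> b \<noteq> 0"
    and u: "u \<noteq> 0"
  obtains c d where "c \<in> K" "d \<in> K" "(c \<odot> u) \<odot> d \<noteq> 0"
proof -
  have Kid: "c \<odot> x \<in> K" "x \<odot> c \<in> K" if "x \<in> K" for x c
    using K that unfolding closed_ideal_def ideal_of_def by auto
  define L where "L = {v. \<forall>x\<in>K. x \<odot> v = 0}"
  define R where "R = {v. \<forall>x\<in>K. v \<odot> x = 0}"
  have "L = (\<Inter>x\<in>K. (\<lambda>v. x \<odot> v) -` {0})" "R = (\<Inter>x\<in>K. (\<lambda>v. v \<odot> x) -` {0})"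
    unfolding L_def R_def by auto
  then have "closed L" "closed R"
    by (auto intro!: closed_INT closed_vimage continuous_mult_left continuous_mult_right)
  moreover have "ideal_of L UNIV"
    unfolding L_def ideal_of_def subspace_def
    by (auto simp: mult_linear_simps) (metis mult_assoc Kid, metis mult_assoc mult_linear_simps(5))
  moreover have "ideal_of R UNIV"
    unfolding R_def ideal_of_def subspace_def
    by (auto simp: mult_linear_simps mult_assoc Kid)
  ultimately have "closed_ideal L" "closed_ideal R" unfolding closed_ideal_def by auto
  then have "L = {0}" "R = {0}" using min ab unfolding L_def R_def by blast+
  then obtain d where d: "d \<in> K" "u \<odot> d \<noteq> 0" using u unfolding R_def by blast
  then obtain c where "c \<in> K" "c \<odot> (u \<odot> d) \<noteq> 0" using \<open>L = {0}\<close> unfolding L_def by blast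
  then show ?thesis using that d by (simp add: mult_assoc)
qed

text \<open>
  \<open>J\<close> is only an ideal of \<open>I\<close>, yet an element \<open>c u d\<close> with factors \<open>c\<close>, \<open>d\<close> in \<open>K\<close> keeps all its
  multiples in \<open>J\<close>.  So the ideal core of \<open>J\<close> is a non-zero closed ideal and minimality applies to it.
\<close>

lemma minimal_closed_ideal_subset_subideal:
  assumes K: "closed_ideal K"
    and min: "\<And>I. \<lbrakk>closed_ideal I; I \<noteq> {0}\<rbrakk> \<Longrightarrow> K \<subseteq> I"
    and ab: "a \<in> K" "b \<in> K" "a \<odot> b \<noteq> 0"
    and "K \<subseteq> I" "ideal_of J I" "closed J" "J \<noteq> {0}"
  shows "K \<subseteq> J"
proof -
  have sub: "subspace J" and J: "\<And>c x. \<lbrakk>c \<in> K; x \<in> J\<rbrakk> \<Longrightarrow> c \<odot> x \<in> J \<and> x \<odot> c \<in> J"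
    using \<open>ideal_of J I\<close> \<open>K \<subseteq> I\<close> unfolding ideal_of_def by auto
  have Kid: "c \<odot> x \<in> K" "x \<odot> c \<in> K" if "x \<in> K" for x c
    using K that unfolding closed_ideal_def ideal_of_def by auto
  obtain u where u: "u \<in> J" "u \<noteq> 0" using \<open>J \<noteq> {0}\<close> subspace_0[OF sub] by blast
  obtain c d where cd: "c \<in> K" "d \<in> K" "(c \<odot> u) \<odot> d \<noteq> 0"
    using nonzero_two_sided_product[OF K min ab u(2)] by blast
  have 1: "(c' \<odot> u) \<odot> d' \<in> J" if "c' \<in> K" "d' \<in> K" for c' d'
    using J u(1) that by blast
  \<comment> \<open>An outer factor is absorbed by the neighbouring factor from \<open>K\<close>.\<close>
  have "e \<odot> ((c \<odot> u) \<odot> d) = ((e \<odot> c) \<odot> u) \<odot> d" "((c \<odot> u) \<odot> d) \<odot> f = (c \<odot> u) \<odot> (d \<odot> f)"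
    "(e \<odot> ((c \<odot> u) \<odot> d)) \<odot> f = ((e \<odot> c) \<odot> u) \<odot> (d \<odot> f)" for e f
    by (simp_all add: mult_assoc)
  then have "(c \<odot> u) \<odot> d \<in> ideal_core J"
    unfolding ideal_core_def using 1 Kid cd(1,2) by simp
  then have "ideal_core J \<noteq> {0}" using cd(3) by blast
  then have "K \<subseteq> ideal_core J" using min closed_ideal_ideal_core[OF \<open>closed J\<close> sub] by blast
  then show ?thesis unfolding ideal_core_def by auto
qed

end

section \<open>Finite-dimensional subspaces\<close>

text \<open>
  For \<open>x \<notin> K\<close> the coefficient of \<open>x\<close> is at most the norm of the vector divided by the distance of
  \<open>x\<close> to \<open>K\<close>.  So in a convergent sequence the coefficients converge, and with them the components
  in \<open>K\<close>.
\<close>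

lemma closed_line_plus:
  fixes x :: "'a::banach"
  assumes "subspace K" "closed K"
  shows "closed (span {x} + K)"
proof (cases "x \<in> K")
  case True
  have "span {x} + K = K"
  proof
    show "span {x} + K \<subseteq> K"
      using True assms(1)
      by (auto simp: span_singleton elim!: set_plus_elim intro!: subspace_add subspace_scale)
    show "K \<subseteq> span {x} + K"
      using set_plus_intro[OF span_zero] by fastforce
  qed
  then show ?thesis using assms(2) by simp
next
  case False
  define d where "d = infdist x K"
  have ne: "K \<noteq> {}" using subspace_0[OF assms(1)] by auto
  have d: "d > 0"
    unfolding d_def using False in_closed_iff_infdist_zero[OF assms(2) ne] infdist_nonneg
    by (simp add: order_less_le)
  have coeff: "\<bar>a\<bar> * d \<le> norm (a *\<^sub>R x + y)" if "y \<in> K" for a y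
  proof (cases "a = 0")
    case False
    have "- (1 / a) *\<^sub>R y \<in> K" using subspace_scale[OF assms(1) that] .
    then have "d \<le> norm (x - (- (1 / a)) *\<^sub>R y)"
      unfolding d_def dist_norm[symmetric] by (rule infdist_le)
    then have "\<bar>a\<bar> * d \<le> \<bar>a\<bar> * norm (x - (- (1 / a)) *\<^sub>R y)"
      by (simp add: mult_left_mono)
    also have "\<dots> = norm (a *\<^sub>R (x - (- (1 / a)) *\<^sub>R y))" by simp
    also have "a *\<^sub>R (x - (- (1 / a)) *\<^sub>R y) = a *\<^sub>R x + y"
      using False by (simp add: algebra_simps)
    finally show ?thesis .
  qed simp
  show ?thesis
    unfolding closed_sequential_limits
  proof (intro allI impI, elim conjE)
    fix f l assume f: "\<forall>n. f n \<in> span {x} + K" and l: "f \<longlonglongrightarrow> l"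
    have "\<exists>a y. f n = a *\<^sub>R x + y \<and> y \<in> K" for n
      using f by (fastforce simp: span_singleton elim!: set_plus_elim)
    then obtain a y where ay: "\<And>n. f n = a n *\<^sub>R x + y n" "\<And>n. y n \<in> K" by metis
    have "Cauchy a"
    proof (rule metric_CauchyI)
      fix e :: real assume "e > 0"
      then obtain M where M: "\<And>m n. \<lbrakk>m \<ge> M; n \<ge> M\<rbrakk> \<Longrightarrow> dist (f m) (f n) < e * d"
        using metric_CauchyD[OF LIMSEQ_imp_Cauchy[OF l], of "e * d"] d by auto
      have "dist (a m) (a n) < e" if "m \<ge> M" "n \<ge> M" for m n
      proof -
        have "\<bar>a m - a n\<bar> * d \<le> norm ((a m - a n) *\<^sub>R x + (y m - y n))"
          by (rule coeff) (rule subspace_diff[OF assms(1) ay(2) ay(2)])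
        also have "\<dots> = dist (f m) (f n)" by (simp add: ay dist_norm algebra_simps)
        also have "\<dots> < e * d" by (rule M[OF that])
        finally show ?thesis using d by (simp add: dist_real_def)
      qed
      then show "\<exists>M. \<forall>m\<ge>M. \<forall>n\<ge>M. dist (a m) (a n) < e" by blast
    qed
    then obtain b where b: "a \<longlonglongrightarrow> b" using convergent_eq_Cauchy by blast
    have "(\<lambda>n. f n - a n *\<^sub>R x) \<longlonglongrightarrow> l - b *\<^sub>R x"
      by (intro tendsto_intros l b)
    then have "y \<longlonglongrightarrow> l - b *\<^sub>R x" by (simp add: ay(1))
    then have "l - b *\<^sub>R x \<in> K"
      using assms(2) ay(2) closed_sequentially by blast
    then have "b *\<^sub>R x + (l - b *\<^sub>R x) \<in> span {x} + K"
      by (intro set_plus_intro) (auto simp: span_singleton)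
    then show "l \<in> span {x} + K" by simp
  qed
qed

lemma subspace_set_plus: "\<lbrakk>subspace A; subspace B\<rbrakk> \<Longrightarrow> subspace (A + B)"
  using subspace_sums[of A B] by (simp add: set_plus_def) (smt (verit) Collect_cong)

lemma span_insert_eq_plus: "span (insert x A) = span {x} + span A"
  using span_Un[of "{x}" A] by (auto simp: set_plus_def)

lemma closed_finite_span_plus:
  fixes A :: "'a::banach set"
  assumes "finite A" "subspace K" "closed K"
  shows "closed (span A + K)"
  using assms(1)
proof induction
  case empty
  have "{0} + K = K" by (simp add: set_plus_def)
  then show ?case using assms(3) by simp
next
  case (insert x A)
  have "closed (span {x} + (span A + K))"
    by (rule closed_line_plus[OF subspace_set_plus[OF subspace_span assms(2)] insert.IH])
  then show ?case by (simp add: span_insert_eq_plus[of x A] add.assoc)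
qed

lemma closed_finite_dimensional_plus:
  fixes K :: "'a::banach set"
  assumes "finite A" "subspace N" "N \<subseteq> span A" "subspace K" "closed K"
  shows "closed (N + K)"
proof -
  obtain B where B: "B \<subseteq> N" "independent B" "N \<subseteq> span B"
    using maximal_independent_subset[of N] by blast
  then have "finite B" using independent_span_bound[OF assms(1)] assms(3) by auto
  moreover have "N = span B" using B assms(2) span_minimal by blast
  ultimately show ?thesis using closed_finite_span_plus assms(4,5) by blast
qed

lemma real_times_lepoll: "\<lbrakk>A \<lesssim> (UNIV::real set); B \<lesssim> (UNIV::real set)\<rbrakk> \<Longrightarrow> A \<times> B \<lesssim> (UNIV::real set)"
proof -
  assume "A \<lesssim> (UNIV::real set)" "B \<lesssim> (UNIV::real set)"
  then have "A \<times> B \<lesssim> (UNIV::real set) \<times> (UNIV::real set)" by (rule times_lepoll_mono)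
  also have "\<dots> \<approx> (UNIV::real set)"
    using card_of_Times_same_infinite[OF infinite_UNIV_char_0] eqpoll_iff_card_of_ordIso by blast
  finally show ?thesis .
qed

lemma finite_span_lepoll_real:
  fixes A :: "'a::real_vector set"
  assumes "finite A"
  shows "span A \<lesssim> (UNIV::real set)"
  using assms
proof induction
  case empty
  then show ?case by (simp add: lepoll_def)
next
  case (insert x A)
  have "span (insert x A) = (\<lambda>(c, y). c *\<^sub>R x + y) ` (UNIV \<times> span A)"
    by (auto simp: span_insert_eq_plus[of x A] span_singleton set_plus_def image_iff)
  also have "\<dots> \<lesssim> (UNIV :: real set) \<times> span A" by (rule image_lepoll)
  also have "\<dots> \<lesssim> (UNIV :: real set)" using insert.IH by (simp add: real_times_lepoll)
  finally show ?case .
qed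

text \<open>
  By induction on the spanning set: a subspace \<open>N\<close> of \<open>span (insert x A)\<close> is spanned by
  \<open>N \<inter> span A\<close> and one further vector, so there are at most as many choices as pairs of a subspace
  of \<open>span A\<close> and a vector.
\<close>

lemma subspaces_lepoll_real:
  fixes A :: "'a::real_vector set"
  assumes "finite A"
  shows "{N. subspace N \<and> N \<subseteq> span A} \<lesssim> (UNIV::real set)"
  using assms
proof induction
  case empty
  have "{N. subspace N \<and> N \<subseteq> span {}} \<subseteq> {{0::'a}}" using subspace_0 by auto
  moreover have "{{0::'a}} \<lesssim> (UNIV::real set)" by (simp add: finite_lepoll_infinite infinite_UNIV_char_0)
  ultimately show ?case using lepoll_trans subset_imp_lepoll by blast
next
  case (insert x A)
  have "N \<in> (\<lambda>(M, v). span (insert v M)) ` ({N. subspace N \<and> N \<subseteq> span A} \<times> span (insert x A))"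
    if N: "subspace N" "N \<subseteq> span (insert x A)" for N
  proof (cases "N \<subseteq> span A")
    case True
    then have "(N, 0) \<in> {N. subspace N \<and> N \<subseteq> span A} \<times> span (insert x A)"
      using N(1) span_zero by auto
    moreover have "N = span (insert 0 N)" using N(1) by (simp add: span_eq_iff[THEN iffD2])
    ultimately show ?thesis by (intro image_eqI[of _ _ "(N, 0)"]) auto
  next
    case False
    then obtain v where v: "v \<in> N" "v \<notin> span A" by auto
    then obtain c where c: "v - c *\<^sub>R x \<in> span A"
      using N(2) span_breakdown_eq by blast
    have "c \<noteq> 0" using c v(2) by auto
    have "N = span (insert v (N \<inter> span A))"
    proof
      show "span (insert v (N \<inter> span A)) \<subseteq> N" by (rule span_minimal) (use v N in auto)
      show "N \<subseteq> span (insert v (N \<inter> span A))"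
      proof
        fix w assume w: "w \<in> N"
        then obtain b where b: "w - b *\<^sub>R x \<in> span A" using N(2) span_breakdown_eq by blast
        \<comment> \<open>Subtract the multiple of \<open>v\<close> with the same \<open>x\<close>-coefficient.\<close>
        have "w - (b / c) *\<^sub>R v = (w - b *\<^sub>R x) - (b / c) *\<^sub>R (v - c *\<^sub>R x)"
          using \<open>c \<noteq> 0\<close> by (simp add: algebra_simps)
        also have "\<dots> \<in> span A" by (intro span_diff span_scale b c)
        finally have "w - (b / c) *\<^sub>R v \<in> N \<inter> span A"
          using w v(1) N(1) by (simp add: subspace_diff subspace_scale)
        then show "w \<in> span (insert v (N \<inter> span A))"
          unfolding span_breakdown_eq by (meson span_base)
      qed
    qed
    moreover have "subspace (N \<inter> span A)" using N(1) by (simp add: subspace_inter)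
    ultimately show ?thesis using v(1) N(2) by (intro image_eqI[of _ _ "(N \<inter> span A, v)"]) auto
  qed
  then have "{N. subspace N \<and> N \<subseteq> span (insert x A)} \<subseteq>
      (\<lambda>(M, v). span (insert v M)) ` ({N. subspace N \<and> N \<subseteq> span A} \<times> span (insert x A))"
    by blast
  then have "{N. subspace N \<and> N \<subseteq> span (insert x A)} \<lesssim> {N. subspace N \<and> N \<subseteq> span A} \<times> span (insert x A)"
    by (meson image_lepoll lepoll_trans subset_imp_lepoll)
  also have "\<dots> \<lesssim> (UNIV :: real set)"
    using insert finite_span_lepoll_real[of "insert x A"] by (simp add: real_times_lepoll)
  finally show ?case .
qed

section \<open>Operators\<close>

lemma compact_operator_rank_one:
  fixes f :: "'a::real_normed_vector \<Rightarrow>\<^sub>L real" and z :: "'b::real_normed_vector"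
  shows "compact_operator (blinfun_scaleR_left z o\<^sub>L f)"
proof -
  let ?C = "(\<lambda>r. r *\<^sub>R z) ` cball 0 (norm f)"
  have C: "compact ?C" by (intro compact_continuous_image continuous_intros compact_cball)
  have "norm (f y) \<le> norm f" if "norm y \<le> 1" for y
    using norm_blinfun[of f y] mult_left_le[OF that norm_ge_zero[of f]] by linarith
  then have "blinfun_apply (blinfun_scaleR_left z o\<^sub>L f) ` cball 0 1 \<subseteq> ?C"
    by (auto simp: image_iff)
  then have "closure (blinfun_apply (blinfun_scaleR_left z o\<^sub>L f) ` cball 0 1) \<subseteq> ?C"
    using C closure_minimal compact_imp_closed by blast
  then show ?thesis
    unfolding compact_operator_def using C closed_closure compact_Int_closed
    by (metis inf.absorb2)
qed

lemma dual_isomorphic_l1_nonzero_functional: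
  assumes "dual_isomorphic_l1 TYPE('a::banach)"
  obtains f :: "'a::banach \<Rightarrow>\<^sub>L real" and x where "f x \<noteq> 0"
proof -
  obtain \<Phi> :: "(nat \<Rightarrow> real) \<Rightarrow> ('a \<Rightarrow>\<^sub>L real)" where "bij_betw \<Phi> l1_sequences UNIV"
    using assms unfolding dual_isomorphic_l1_def by blast
  moreover have "(\<lambda>n. 0) \<in> l1_sequences" "(\<lambda>n. if n = 0 then 1 else 0) \<in> l1_sequences"
    unfolding l1_sequences_def by (auto intro: summable_finite[of "{0}"])
  moreover have "(\<lambda>n::nat. 0) \<noteq> (\<lambda>n. if n = 0 then 1 else (0::real))" by (auto dest: fun_cong[of _ _ 0])
  ultimately have "\<Phi> (\<lambda>n. 0) \<noteq> \<Phi> (\<lambda>n. if n = 0 then 1 else 0)"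
    unfolding bij_betw_def inj_on_def by blast
  then obtain x where "\<Phi> (\<lambda>n. 0) x \<noteq> 0 \<or> \<Phi> (\<lambda>n. if n = 0 then 1 else 0) x \<noteq> 0"
    by (metis blinfun_eqI)
  then show ?thesis using that by blast
qed

text \<open>
  The square of the rank-one operator \<open>y \<mapsto> f(y) x\<close> is \<open>f(x)\<close> times that operator.  A functional
  and a vector with \<open>f(x) \<noteq> 0\<close> come from the description of the dual as \<open>\<ell>\<^sup>1\<close>.
\<close>

lemma compact_ops_nonzero_product:
  assumes "dual_isomorphic_l1 TYPE('a::banach)"
  obtains P :: "'a::banach \<Rightarrow>\<^sub>L 'a" where "P \<in> \<K>" "P o\<^sub>L P \<noteq> 0"
proof -
  obtain f :: "'a \<Rightarrow>\<^sub>L real" and x where fx: "f x \<noteq> 0"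
    using dual_isomorphic_l1_nonzero_functional[OF assms] by blast
  let ?P = "blinfun_scaleR_left x o\<^sub>L f"
  have "?P (?P x) = (f x * f x) *\<^sub>R x" by (simp add: blinfun.scaleR_right)
  moreover have "x \<noteq> 0" using fx by (auto simp: blinfun.zero_right)
  ultimately have "?P o\<^sub>L ?P \<noteq> 0" using fx by (metis blinfun_apply_blinfun_compose no_zero_divisors scaleR_eq_0_iff zero_blinfun.rep_eq)
  moreover have "?P \<in> \<K>" unfolding compact_ops_def by (simp add: compact_operator_rank_one)
  ultimately show ?thesis using that by blast
qed

lemma op_pow_add: "T ^\<^sub>L (m + n) = (T ^\<^sub>L m) o\<^sub>L (T ^\<^sub>L n)"
  by (induction m) (auto intro: blinfun_eqI)

lemma op_pow_1: "T ^\<^sub>L 1 = T"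
  by (auto intro: blinfun_eqI)

lemma op_pow_eq_0: "\<lbrakk>T ^\<^sub>L k = 0; k \<le> n\<rbrakk> \<Longrightarrow> T ^\<^sub>L n = 0"
  using op_pow_add[of T "n - k" k] by (auto intro: blinfun_eqI)

lemma subspace_power_span: "subspace (power_span S j k)"
  unfolding power_span_def by simp

lemma power_span_mono: "i \<le> j \<Longrightarrow> power_span S j k \<subseteq> power_span S i k"
  unfolding power_span_def by (intro span_mono image_mono) auto

lemma op_pow_in_power_span: "\<lbrakk>j \<le> i; i \<le> k - 1\<rbrakk> \<Longrightarrow> S ^\<^sub>L i \<in> power_span S j k"
  unfolding power_span_def by (intro span_base) auto

text \<open>
  By bilinearity only products \<open>S\<^sup>a S\<^sup>b = S\<^bsup>a+b\<^esup>\<close> with \<open>a + b \<ge> k\<close> matter.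
\<close>

lemma power_span_compose_eq_0:
  fixes S :: "'a::banach \<Rightarrow>\<^sub>L 'a"
  assumes "S ^\<^sub>L k = 0" "k \<le> i + j" "x \<in> power_span S i k" "y \<in> power_span S j k"
  shows "x o\<^sub>L y = 0"
proof -
  have *: "(S ^\<^sub>L a) o\<^sub>L y = 0" if "a \<ge> i" for a
    using assms(4) unfolding power_span_def
  proof (induction rule: span_induct)
    case base
    show ?case unfolding subspace_def by (simp add: op_alg.mult_linear_simps)
  next
    case (step z)
    then obtain b where "b \<ge> j" "z = S ^\<^sub>L b" by auto
    then show ?case using op_pow_eq_0[OF assms(1), of "a + b"] op_pow_add[of S a b] assms(2) that by simp
  qed
  show ?thesis
    using assms(3) unfolding power_span_def
  proof (induction rule: span_induct)
    case base
    show ?case unfolding subspace_def by (simp add: op_alg.mult_linear_simps)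
  next
    case (step z)
    then show ?case using * by auto
  qed
qed

lemma power_span_1_sum:
  assumes "x \<in> power_span S 1 k"
  shows "\<exists>a::nat \<Rightarrow> real. (\<forall>j. j \<notin> {1..k - 1} \<longrightarrow> a j = 0) \<and> x = (\<Sum>j = 1..k - 1. a j *\<^sub>R (S ^\<^sub>L j))"
  using assms unfolding power_span_def
proof (induction rule: span_induct_alt)
  case base
  show ?case by (rule exI[of _ "\<lambda>_. 0"]) simp
next
  case (step c z y)
  then obtain i a where i: "i \<in> {1..k - 1}" "z = S ^\<^sub>L i"
    and a: "\<forall>j. j \<notin> {1..k - 1} \<longrightarrow> a j = 0" "y = (\<Sum>j = 1..k - 1. a j *\<^sub>R (S ^\<^sub>L j))" by auto
  have "(\<Sum>j = 1..k - 1. ((if j = i then c else 0) + a j) *\<^sub>R (S ^\<^sub>L j)) = c *\<^sub>R z + y"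
    using i by (simp add: scaleR_add_left sum.distrib a(2) if_distrib[of "\<lambda>t. t *\<^sub>R _"] cong: if_cong)
  then show ?case using a(1) i(1) by (intro exI[of _ "\<lambda>j. (if j = i then c else 0) + a j"]) auto
qed

section \<open>Tarbard spaces\<close>

locale tarbard =
  fixes S :: "'a::banach \<Rightarrow>\<^sub>L 'a" and k :: nat
  assumes tarbard: "tarbard_space k S"
begin

abbreviation G :: "nat \<Rightarrow> ('a \<Rightarrow>\<^sub>L 'a) set" where
  "G r \<equiv> op_alg.generated_closed_ideal (S ^\<^sub>L r)"

lemma k_ge_2: "k \<ge> 2"
  and dual_l1: "dual_isomorphic_l1 TYPE('a)"
  and representation: "tarbard_representation k S"
  and ideal_chain: "tarbard_ideal_chain k S"
  using tarbard unfolding tarbard_space_def by simp_all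

lemma top_power_not_compact: "S ^\<^sub>L (k - 1) \<notin> \<K>"
  using representation unfolding tarbard_representation_def by (elim conjE)

lemma pow_k: "S ^\<^sub>L k = 0"
  using representation unfolding tarbard_representation_def by (elim conjE)

lemma unique_representation:
  "\<exists>!p. case p of (\<alpha> :: real, a :: nat \<Rightarrow> real, T) \<Rightarrow>
        (\<forall>j. j \<notin> {1..k - 1} \<longrightarrow> a j = 0) \<and> T \<in> \<K> \<and>
        U = \<alpha> *\<^sub>R id_blinfun + (\<Sum>j = 1..k - 1. a j *\<^sub>R (S ^\<^sub>L j)) + T"
  using representation unfolding tarbard_representation_def by (elim conjE) (erule spec)

lemma closed_ideals:
  "{I. op_alg.closed_ideal I \<and> I \<noteq> {0}} = {\<K>} \<union> G ` {1..k - 1} \<union> {UNIV}"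
  using ideal_chain unfolding tarbard_ideal_chain_def by (elim conjE)

lemma closed_ideal_in_chain:
  fixes I :: "('a \<Rightarrow>\<^sub>L 'a) set"
  assumes "op_alg.closed_ideal I" "I \<noteq> {0}"
  shows "I = \<K> \<or> (\<exists>r\<in>{1..k - 1}. I = G r) \<or> I = UNIV"
proof -
  have "I \<in> {I. op_alg.closed_ideal I \<and> I \<noteq> {0}}" using assms by simp
  then show ?thesis unfolding closed_ideals by auto
qed

lemma closed_ideal_compact: "op_alg.closed_ideal (\<K> :: ('a \<Rightarrow>\<^sub>L 'a) set)"
proof -
  have "(\<K> :: ('a \<Rightarrow>\<^sub>L 'a) set) \<in> {I. op_alg.closed_ideal I \<and> I \<noteq> {0}}" unfolding closed_ideals by simp
  then show ?thesis by simp
qed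

lemma compact_ops_subspace: "subspace (\<K> :: ('a \<Rightarrow>\<^sub>L 'a) set)"
  and compact_ops_closed: "closed (\<K> :: ('a \<Rightarrow>\<^sub>L 'a) set)"
  using closed_ideal_compact unfolding op_alg.closed_ideal_def op_alg.ideal_of_def by auto

lemma compact_ops_ideal:
  fixes T U :: "'a \<Rightarrow>\<^sub>L 'a"
  shows "T \<in> \<K> \<Longrightarrow> U o\<^sub>L T \<in> \<K>" "T \<in> \<K> \<Longrightarrow> T o\<^sub>L U \<in> \<K>"
  using closed_ideal_compact unfolding op_alg.closed_ideal_def op_alg.ideal_of_def by auto

lemma generated_eq: "r \<in> {1..k - 1} \<Longrightarrow> G r = power_span S r k + \<K>"
  using ideal_chain unfolding tarbard_ideal_chain_def by (elim conjE) (erule bspec)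

lemma generated_strict: "r \<in> {1..<k - 1} \<Longrightarrow> G (r + 1) \<subset> G r"
  using ideal_chain unfolding tarbard_ideal_chain_def by (elim conjE) (erule bspec)

lemma generated_1_neq_UNIV: "G 1 \<noteq> UNIV"
proof -
  have "op_alg.generated_closed_ideal S = \<S>"
    using ideal_chain unfolding tarbard_ideal_chain_def by (elim conjE)
  moreover have "\<S> \<subset> (UNIV :: ('a \<Rightarrow>\<^sub>L 'a) set)"
    using ideal_chain unfolding tarbard_ideal_chain_def by (elim conjE)
  ultimately show ?thesis unfolding op_pow_1 by simp
qed

lemma generated_antimono: "r \<le> s \<Longrightarrow> G s \<subseteq> G r"
proof -
  assume "r \<le> s"
  then have "S ^\<^sub>L s = (S ^\<^sub>L (s - r)) o\<^sub>L (S ^\<^sub>L r)" 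
    by (metis le_add_diff_inverse2 op_pow_add)
  moreover have "op_alg.ideal_of (G r) UNIV"
    using op_alg.closed_ideal_generated unfolding op_alg.closed_ideal_def by blast
  ultimately have "S ^\<^sub>L s \<in> G r"
    using op_alg.generator_in_generated_closed_ideal[of "S ^\<^sub>L r"] unfolding op_alg.ideal_of_def by simp
  then show ?thesis
    using op_alg.closed_ideal_generated op_alg.generated_closed_ideal_subset by blast
qed

lemma subset_plus_compact:
  fixes N :: "('a \<Rightarrow>\<^sub>L 'a) set"
  shows "subspace N \<Longrightarrow> \<K> \<subseteq> N + \<K>" "N \<subseteq> N + \<K>"
  using set_plus_intro[of 0 N _ \<K>] set_plus_intro[of _ N 0 \<K>] subspace_0 compact_ops_subspace
  by fastforce+

lemma compact_subset_closed_ideal: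
  fixes I :: "('a \<Rightarrow>\<^sub>L 'a) set"
  assumes "op_alg.closed_ideal I" "I \<noteq> {0}"
  shows "\<K> \<subseteq> I"
  using closed_ideal_in_chain[OF assms]
  by (metis generated_eq subset_plus_compact(1) subspace_power_span order_refl top_greatest)

text \<open>
  The compact operators satisfy the hypotheses of the abstract minimality lemma: they are contained
  in every ideal of the chain, and not all products of two compact operators vanish.
\<close>

lemma compact_subset_subideal:
  fixes I :: "('a \<Rightarrow>\<^sub>L 'a) set"
  assumes "op_alg.closed_ideal I" "op_alg.ideal_of J I" "closed J" "J \<noteq> {0}"
  shows "\<K> \<subseteq> J"
proof -
  obtain P :: "'a \<Rightarrow>\<^sub>L 'a" where "P \<in> \<K>" "P o\<^sub>L P \<noteq> 0"
    using compact_ops_nonzero_product[OF dual_l1] by blast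
  moreover have "I \<noteq> {0}"
    using assms(2,4) subspace_0 unfolding op_alg.ideal_of_def by blast
  ultimately show ?thesis
    using op_alg.minimal_closed_ideal_subset_subideal[OF closed_ideal_compact
        _ _ _ _ compact_subset_closed_ideal[OF assms(1)] assms(2-4)]
      compact_subset_closed_ideal by blast
qed

text \<open>
  Otherwise \<open>x\<close> would have two representations, one with all of \<open>x\<close> in the powers of \<open>S\<close> and one
  with all of \<open>x\<close> in the compact part.
\<close>

lemma power_span_compact_disjoint:
  assumes "x \<in> power_span S r k" "1 \<le> r" "x \<in> \<K>"
  shows "x = 0"
proof -
  obtain a :: "nat \<Rightarrow> real" where a: "\<forall>j. j \<notin> {1..k - 1} \<longrightarrow> a j = 0"
    "x = (\<Sum>j = 1..k - 1. a j *\<^sub>R (S ^\<^sub>L j))"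
    using power_span_1_sum power_span_mono[OF assms(2)] assms(1) by blast
  define P where "P = (\<lambda>p. case p of (\<alpha> :: real, a :: nat \<Rightarrow> real, T) \<Rightarrow>
        (\<forall>j. j \<notin> {1..k - 1} \<longrightarrow> a j = 0) \<and> T \<in> \<K> \<and>
        x = \<alpha> *\<^sub>R id_blinfun + (\<Sum>j = 1..k - 1. a j *\<^sub>R (S ^\<^sub>L j)) + T)"
  have "\<exists>!p. P p"
    unfolding P_def by (rule unique_representation)
  moreover have "P (0, a, 0)" unfolding P_def using a subspace_0[OF compact_ops_subspace] by simp
  moreover have "P (0, \<lambda>_. 0, x)" unfolding P_def using assms(3) by simp
  ultimately have "(0::real, a, 0) = (0::real, \<lambda>_. 0, x)" by blast
  then show ?thesis by simp
qed

lemma plus_compact_inject: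
  fixes N M :: "('a \<Rightarrow>\<^sub>L 'a) set"
  assumes "N + \<K> = M + \<K>" "subspace N" "subspace M"
    and NM: "N \<subseteq> power_span S r k" "M \<subseteq> power_span S r k" "1 \<le> r"
  shows "N = M"
proof -
  have "N' \<subseteq> M'" if eq: "N' + \<K> = M' + \<K>" and N': "N' \<subseteq> power_span S r k" and M': "M' \<subseteq> power_span S r k" for N' M'
  proof
    fix x assume x: "x \<in> N'"
    then obtain m T where mT: "x = m + T" "m \<in> M'" "T \<in> \<K>"
      using subset_plus_compact(2) eq by (blast elim: set_plus_elim)
    have "x - m \<in> power_span S r k"
      using subspace_diff[OF subspace_power_span] x mT(2) N' M' by blast
    then have "x - m = 0" using power_span_compact_disjoint[of "x - m"] mT NM(3) by simp
    then show "x \<in> M'" using mT(2) by simp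
  qed
  then show ?thesis using assms by (metis subset_antisym)
qed

text \<open>
  Since \<open>J\<close> contains \<open>\<K>\<close>, subtracting the compact part of an element does not leave \<open>J\<close>.
\<close>

lemma subideal_decomposition:
  assumes "r \<in> {1..k - 1}" "op_alg.ideal_of J (G r)" "closed J" "J \<noteq> {0}"
  shows "J = (power_span S r k \<inter> J) + \<K>" "subspace (power_span S r k \<inter> J)"
proof -
  have KJ: "\<K> \<subseteq> J" by (rule compact_subset_subideal[OF op_alg.closed_ideal_generated assms(2-4)])
  have J: "subspace J" "J \<subseteq> power_span S r k + \<K>"
    using assms(2) generated_eq[OF assms(1)] unfolding op_alg.ideal_of_def by auto
  show "subspace (power_span S r k \<inter> J)" 
    by (rule subspace_inter[OF subspace_power_span J(1)])
  show "J = (power_span S r k \<inter> J) + \<K>"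
  proof
    show "J \<subseteq> (power_span S r k \<inter> J) + \<K>"
    proof
      fix x assume x: "x \<in> J"
      then obtain p T where pT: "x = p + T" "p \<in> power_span S r k" "T \<in> \<K>"
        using J(2) by (blast elim: set_plus_elim)
      have "x - T \<in> J" using subspace_diff[OF J(1) x] pT(3) KJ by blast
      then show "x \<in> (power_span S r k \<inter> J) + \<K>" using pT by (auto intro: set_plus_intro)
    qed
    show "(power_span S r k \<inter> J) + \<K> \<subseteq> J"
      using KJ subspace_add[OF J(1)] by (blast elim: set_plus_elim)
  qed
qed

lemma ideal_of_generated: "op_alg.ideal_of (G r) UNIV"
  using op_alg.closed_ideal_generated unfolding op_alg.closed_ideal_def by blast

lemma ideal_of_compact: "op_alg.ideal_of (\<K> :: ('a \<Rightarrow>\<^sub>L 'a) set) UNIV"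
  using closed_ideal_compact unfolding op_alg.closed_ideal_def by blast

text \<open>
  Modulo \<open>\<K>\<close> the ideal is the line spanned by \<open>S\<^bsup>k-1\<^esup>\<close>, which leaves only \<open>J = \<K>\<close> and \<open>J = [S\<^bsup>k-1\<^esup>]\<close>.
\<close>

lemma subideal_of_minimal_trivial:
  assumes "op_alg.ideal_of J (G (k - 1))" "closed J" "J \<noteq> {0}"
  shows "op_alg.ideal_of J UNIV"
proof -
  have r: "k - 1 \<in> {1..k - 1}" using k_ge_2 by simp
  define N where "N = power_span S (k - 1) k \<inter> J"
  have N: "J = N + \<K>" "subspace N"
    unfolding N_def by (rule subideal_decomposition[OF r assms])+
  have P: "power_span S (k - 1) k = span {S ^\<^sub>L (k - 1)}" unfolding power_span_def by simp
  show ?thesis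
  proof (cases "N \<subseteq> {0}")
    case True
    then have "N = {0}" using subspace_0[OF N(2)] by blast
    then have "J = \<K>" using N(1) by (simp add: set_plus_def)
    then show ?thesis using ideal_of_compact by simp
  next
    case False
    then obtain c where c: "c *\<^sub>R (S ^\<^sub>L (k - 1)) \<in> N" "c \<noteq> 0"
      unfolding N_def P span_singleton by fastforce
    then have "S ^\<^sub>L (k - 1) \<in> N" using subspace_scale[OF N(2) c(1), of "1 / c"] by simp
    then have "power_span S (k - 1) k \<subseteq> N" unfolding P using span_minimal N(2) by blast
    then have "N = power_span S (k - 1) k" unfolding N_def by blast
    then have "J = G (k - 1)" using N(1) generated_eq[OF r] by simp
    then show ?thesis using ideal_of_generated by simp
  qed
qed

text \<open>
  If \<open>J\<close> is not inside \<open>[S\<^sup>2]\<close>, it contains some \<open>p = a S + b S\<^sup>2\<close> with \<open>a \<noteq> 0\<close>.  As \<open>S \<in> [S]\<close> and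
  \<open>S\<^sup>3 = 0\<close>, also \<open>S p = a S\<^sup>2\<close> lies in \<open>J\<close>, hence \<open>S\<^sup>2\<close> and then \<open>S\<close>, so \<open>J = [S]\<close>.
\<close>

lemma subideal_of_singular_trivial:
  assumes k3: "k = 3" and J: "op_alg.ideal_of J (G 1)" "closed J" "J \<noteq> {0}"
  shows "op_alg.ideal_of J UNIV"
proof (cases "J \<subseteq> G 2")
  case True
  then have "op_alg.ideal_of J (G (k - 1))"
    using J(1) generated_antimono[of 1 2] k3 unfolding op_alg.ideal_of_def by auto
  then show ?thesis using subideal_of_minimal_trivial J by blast
next
  case False
  then obtain x where x: "x \<in> J" "x \<notin> G 2" by blast
  have r: "1 \<in> {1..k - 1}" "2 \<in> {1..k - 1}" using k3 by auto
  have P2: "power_span S 2 k = span {S ^\<^sub>L 2}" unfolding power_span_def k3 by simp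
  have "{1..3 - 1::nat} = {1, 2}" by auto
  then have P1: "power_span S 1 k = span {S, S ^\<^sub>L 2}"
    unfolding power_span_def k3 by (simp only: image_insert image_empty op_pow_1)
  define N where "N = power_span S 1 k \<inter> J"
  have N: "J = N + \<K>" "subspace N"
    unfolding N_def by (rule subideal_decomposition[OF r(1) J])+
  obtain p T where pT: "x = p + T" "p \<in> N" "T \<in> \<K>" using x(1) N(1) by (blast elim: set_plus_elim)
  obtain a where a: "p - a *\<^sub>R S \<in> span {S ^\<^sub>L 2}"
    using pT(2) span_breakdown_eq[of p S "{S ^\<^sub>L 2}"] unfolding N_def P1 by blast
  have "a \<noteq> 0"
  proof
    assume "a = 0"
    then have "x \<in> G 2" using a pT unfolding generated_eq[OF r(2)] P2 by (auto intro: set_plus_intro)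
    then show False using x(2) by simp
  qed
  have SJ: "S o\<^sub>L p \<in> J"
    using J(1) op_alg.generator_in_generated_closed_ideal[of "S ^\<^sub>L 1"] pT(2)
    unfolding op_alg.ideal_of_def N_def op_pow_1 by blast
  have "S \<in> power_span S 1 k"
    using op_pow_in_power_span[of 1 1 k S] k3 unfolding op_pow_1 by simp
  moreover have "p - a *\<^sub>R S \<in> power_span S 2 k" using a unfolding P2 .
  moreover have "k \<le> 1 + 2" using k3 by simp
  ultimately have "S o\<^sub>L (p - a *\<^sub>R S) = 0"
    using power_span_compose_eq_0[OF pow_k] by blast
  moreover have "S o\<^sub>L p = (S o\<^sub>L (p - a *\<^sub>R S)) + a *\<^sub>R (S o\<^sub>L S)"
    using op_alg.mult_linear_simps(2)[of S "p - a *\<^sub>R S" "a *\<^sub>R S"]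
    by (simp add: op_alg.mult_linear_simps(4))
  moreover have "S o\<^sub>L S = S ^\<^sub>L 2"
    using op_pow_add[of S 1 1] by (simp only: op_pow_1 one_add_one)
  ultimately have "a *\<^sub>R (S ^\<^sub>L 2) \<in> J" using SJ by simp
  moreover have subJ: "subspace J" using J(1) unfolding op_alg.ideal_of_def by blast
  ultimately have S2: "S ^\<^sub>L 2 \<in> J" using \<open>a \<noteq> 0\<close> subspace_scale[of J "a *\<^sub>R (S ^\<^sub>L 2)" "1 / a"] by simp
  then have "p - a *\<^sub>R S \<in> J" using a span_minimal[of "{S ^\<^sub>L 2}" J] subJ by blast
  then have "p - (p - a *\<^sub>R S) \<in> J" using pT(2) subspace_diff[OF subJ, of p] unfolding N_def by blast
  then have "S \<in> J" using \<open>a \<noteq> 0\<close> subspace_scale[OF subJ, of "a *\<^sub>R S" "1 / a"] by simp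
  then have "power_span S 1 k \<subseteq> J" unfolding P1 using S2 subJ by (intro span_minimal) auto
  then have "N = power_span S 1 k" unfolding N_def by blast
  then have "J = G 1" using N(1) generated_eq[OF r(1)] by simp
  then show ?thesis by (simp only: ideal_of_generated)
qed

lemma no_nontrivial_subideals:
  fixes J :: "('a \<Rightarrow>\<^sub>L 'a) set"
  assumes "k = 2 \<or> k = 3"
  shows "\<not> op_alg.nontrivial_closed_subideal J"
proof
  assume "op_alg.nontrivial_closed_subideal J"
  then obtain I where I: "op_alg.closed_ideal I" "I \<noteq> UNIV" "op_alg.ideal_of J I" "closed J"
    "\<not> op_alg.ideal_of J UNIV"
    unfolding op_alg.nontrivial_closed_subideal_def op_alg.nontrivial_closed_subideal_in_def
      op_alg.closed_subideal_in_def op_alg.closed_subalgebra_def by blast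
  have J0: "J \<noteq> {0}"
    using I(5) unfolding op_alg.ideal_of_def by (auto simp: op_alg.mult_linear_simps)
  then have KJ: "\<K> \<subseteq> J" using compact_subset_subideal I by blast
  have "I \<noteq> {0}" using I(3) J0 subspace_0 unfolding op_alg.ideal_of_def by blast
  then consider "I = \<K>" | r where "r \<in> {1..k - 1}" "I = G r"
    using closed_ideal_in_chain I(1,2) by blast
  then show False
  proof cases
    case 1
    then have "J = \<K>" using KJ I(3) unfolding op_alg.ideal_of_def by blast
    then show False using I(5) ideal_of_compact by simp
  next
    case 2
    then consider "r = k - 1" | "k = 3" "r = 1" using assms by fastforce
    then show False
      using subideal_of_minimal_trivial subideal_of_singular_trivial I J0 2 by cases auto
  qed
qed

text \<open>
  The excluded subspaces \<open>N\<close> are those for which \<open>N + \<K>\<close> is \<open>\<K>\<close> or some \<open>[S\<^sup>r]\<close>, which are ideals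
  of the whole algebra.
\<close>

lemma nontrivial_subideal_form:
  assumes j: "1 \<le> j" "j \<le> k - 1"
    and J: "op_alg.nontrivial_closed_subideal_in (G j) J"
  shows "\<exists>N. J = N + \<K> \<and> subspace N \<and> N \<noteq> {0} \<and> N \<subseteq> power_span S j k \<and>
    (\<forall>r\<in>{j..k - 1}. N \<noteq> power_span S r k)"
proof -
  have J': "op_alg.ideal_of J (G j)" "closed J" "\<not> op_alg.ideal_of J UNIV"
    using J unfolding op_alg.nontrivial_closed_subideal_in_def
      op_alg.closed_subideal_in_def op_alg.closed_subalgebra_def by auto
  have J0: "J \<noteq> {0}"
    using J'(3) unfolding op_alg.ideal_of_def by (auto simp: op_alg.mult_linear_simps)
  define N where "N = power_span S j k \<inter> J"
  have N: "J = N + \<K>" "subspace N"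
    unfolding N_def using subideal_decomposition[OF _ J'(1,2) J0] j by auto
  have "N \<noteq> {0}" using N(1) J'(3) ideal_of_compact by (auto simp: set_plus_def)
  moreover have "N \<noteq> power_span S r k" if "r \<in> {j..k - 1}" for r
    using N(1) J'(3) ideal_of_generated[of r] generated_eq[of r] that j by auto
  moreover have "N \<subseteq> power_span S j k" unfolding N_def by blast
  ultimately show ?thesis using N by blast
qed

lemma generated_products_compact:
  assumes j: "1 \<le> j" "j \<le> k - 1" "k \<le> 2 * j" and xy: "x \<in> G j" "y \<in> G j"
  shows "x o\<^sub>L y \<in> \<K>"
proof -
  have G: "G j = power_span S j k + \<K>" using generated_eq j by simp
  obtain p T where p: "x = p + T" "p \<in> power_span S j k" "T \<in> \<K>"
    using xy(1) unfolding G by (blast elim: set_plus_elim)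
  obtain q R where q: "y = q + R" "q \<in> power_span S j k" "R \<in> \<K>"
    using xy(2) unfolding G by (blast elim: set_plus_elim)
  have "p o\<^sub>L q = 0" by (rule power_span_compose_eq_0[OF pow_k _ p(2) q(2)]) (use j in simp)
  then have "x o\<^sub>L y = (p o\<^sub>L R) + (T o\<^sub>L (q + R))"
    unfolding p(1) q(1) by (simp add: op_alg.mult_linear_simps)
  then show ?thesis using subspace_add[OF compact_ops_subspace] compact_ops_ideal p(3) q(3) by simp
qed

text \<open>
  All products of elements of \<open>[S\<^sup>j]\<close> fall into \<open>\<K>\<close>, so \<open>N + \<K>\<close> is an ideal of \<open>[S\<^sup>j]\<close> whatever \<open>N\<close>
  is.  Non-triviality is read off from the list of closed ideals: equality with \<open>[S\<^sup>r]\<close> contradicts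
  the hypothesis on \<open>N\<close> if \<open>r \<ge> j\<close>, and the strictness of the chain if \<open>r < j\<close>.
\<close>

lemma nontrivial_subideal_plus_compact:
  assumes j: "1 \<le> j" "j \<le> k - 1" "k \<le> 2 * j"
    and N: "subspace N" "N \<noteq> {0}" "N \<subseteq> power_span S j k" "\<forall>r\<in>{j..k - 1}. N \<noteq> power_span S r k"
  shows "op_alg.nontrivial_closed_subideal_in (G j) (N + \<K>)"
proof -
  let ?J = "N + \<K>"
  have jr: "j \<in> {1..k - 1}" using j by simp
  have sub: "subspace ?J" using subspace_set_plus N(1) compact_ops_subspace by blast
  have cl: "closed ?J"
    by (rule closed_finite_dimensional_plus[OF _ N(1) N(3)[unfolded power_span_def]
          compact_ops_subspace compact_ops_closed]) simp
  have JG: "?J \<subseteq> G j" unfolding generated_eq[OF jr] using N(3) by (simp add: set_plus_mono2)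
  have prod: "x o\<^sub>L y \<in> ?J" if "x \<in> G j" "y \<in> G j" for x y
    using generated_products_compact[OF j that] subset_plus_compact(1)[OF N(1)] by blast
  have "op_alg.closed_subalgebra ?J"
    unfolding op_alg.closed_subalgebra_def using sub cl prod JG by blast
  moreover have "op_alg.closed_subalgebra (G j)"
    using op_alg.closed_ideal_generated[of "S ^\<^sub>L j"]
    unfolding op_alg.closed_subalgebra_def op_alg.closed_ideal_def op_alg.ideal_of_def by blast
  moreover have "op_alg.ideal_of ?J (G j)"
    unfolding op_alg.ideal_of_def using sub prod JG by blast
  moreover have "\<not> op_alg.ideal_of ?J UNIV"
  proof
    assume "op_alg.ideal_of ?J UNIV"
    then have "op_alg.closed_ideal ?J" using cl unfolding op_alg.closed_ideal_def by blast
    moreover obtain n where n: "n \<in> N" "n \<noteq> 0" using N(2) subspace_0[OF N(1)] by blast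
    then have "?J \<noteq> {0}" using subset_plus_compact(2)[of N] by blast
    ultimately consider "?J = \<K>" | r where "r \<in> {1..k - 1}" "?J = G r" | "?J = UNIV"
      using closed_ideal_in_chain by blast
    then show False
    proof cases
      case 1
      then have "n \<in> \<K>" using n(1) subset_plus_compact(2)[of N] by blast
      then show False using power_span_compact_disjoint n N(3) j(1) by blast
    next
      case (2 r)
      show False
      proof (cases "j \<le> r")
        case True
        have "N = power_span S r k"
          by (rule plus_compact_inject[OF _ N(1) subspace_power_span N(3) power_span_mono[OF True] j(1)])
             (use 2 generated_eq in simp)
        then show False using N(4) True 2(1) by auto
      next
        case False
        then have "G j \<subseteq> G (r + 1)" by (intro generated_antimono) simp
        moreover have "G (r + 1) \<subset> G r" by (rule generated_strict) (use 2 False j in auto)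
        ultimately show False using JG 2(2) by blast
      qed
    next
      case 3
      then have "G 1 = UNIV" using JG generated_antimono[OF j(1)] by blast
      then show False using generated_1_neq_UNIV by simp
    qed
  qed
  ultimately show ?thesis
    unfolding op_alg.nontrivial_closed_subideal_in_def op_alg.closed_subideal_in_def
    using ideal_of_generated by blast
qed

lemma nontrivial_subideals_eq:
  assumes j: "1 \<le> j" "j \<le> k - 1" "k \<le> 2 * j"
  shows "{J. op_alg.nontrivial_closed_subideal_in (G j) J} =
    {N + \<K> | N. subspace N \<and> N \<noteq> {0} \<and> N \<subseteq> power_span S j k \<and>
      (\<forall>r\<in>{j..k - 1}. N \<noteq> power_span S r k)}"
proof (intro equalityI subsetI)
  fix J assume "J \<in> {J. op_alg.nontrivial_closed_subideal_in (G j) J}"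
  then show "J \<in> {N + \<K> | N. subspace N \<and> N \<noteq> {0} \<and> N \<subseteq> power_span S j k \<and>
      (\<forall>r\<in>{j..k - 1}. N \<noteq> power_span S r k)}"
    using nontrivial_subideal_form[OF j(1,2)] by simp
next
  fix J assume "J \<in> {N + \<K> | N. subspace N \<and> N \<noteq> {0} \<and> N \<subseteq> power_span S j k \<and>
      (\<forall>r\<in>{j..k - 1}. N \<noteq> power_span S r k)}"
  then obtain N where "J = N + \<K>" "subspace N" "N \<noteq> {0}" "N \<subseteq> power_span S j k"
    "\<forall>r\<in>{j..k - 1}. N \<noteq> power_span S r k" by (elim CollectE exE conjE)
  then show "J \<in> {J. op_alg.nontrivial_closed_subideal_in (G j) J}"
    using nontrivial_subideal_plus_compact[OF j] by simp
qed

text \<open>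
  Multiplication by \<open>S\<close> moves the first term to \<open>S\<^bsup>k-1\<^esup> \<noteq> 0\<close> and kills the second.
\<close>

lemma top_powers_independent:
  assumes "a *\<^sub>R (S ^\<^sub>L (k - 2)) + b *\<^sub>R (S ^\<^sub>L (k - 1)) = 0"
  shows "a = 0" "b = 0"
proof -
  have ne: "S ^\<^sub>L (k - 1) \<noteq> 0" using top_power_not_compact subspace_0[OF compact_ops_subspace] by metis
  have "k - 1 = Suc (k - 2)" "k = Suc (k - 1)" using k_ge_2 by auto
  then have s: "S o\<^sub>L (S ^\<^sub>L (k - 2)) = S ^\<^sub>L (k - 1)" "S o\<^sub>L (S ^\<^sub>L (k - 1)) = 0"
    using pow_k by (metis op_pow.simps(2))+
  have "S o\<^sub>L (a *\<^sub>R (S ^\<^sub>L (k - 2)) + b *\<^sub>R (S ^\<^sub>L (k - 1))) = 0"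
    by (simp only: assms op_alg.mult_linear_simps)
  then have "a *\<^sub>R (S ^\<^sub>L (k - 1)) = 0"
    by (simp only: op_alg.mult_linear_simps s scaleR_zero_right add_0_right)
  then show "a = 0" using ne by simp
  then show "b = 0" using assms ne by simp
qed

text \<open>
  For the lower bound, the lines through \<open>v t = S\<^bsup>k-2\<^esup> + t S\<^bsup>k-1\<^esup>\<close> are distinct and admissible: every
  excluded span contains \<open>S\<^bsup>k-1\<^esup>\<close>, but none of these lines does.  The bound \<open>j \<le> k - 2\<close> makes room
  for them.
\<close>

lemma nontrivial_subideals_continuum:
  assumes j: "1 \<le> j" "j \<le> k - 2" "k \<le> 2 * j"
  shows "{J. op_alg.nontrivial_closed_subideal_in (G j) J} \<approx> (UNIV :: real set)"
proof (rule lepoll_antisym)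
  have j': "j \<le> k - 1" using j by simp
  have "{J. op_alg.nontrivial_closed_subideal_in (G j) J} \<subseteq>
      (\<lambda>N. N + \<K>) ` {N. subspace N \<and> N \<subseteq> power_span S j k}"
    unfolding nontrivial_subideals_eq[OF j(1) j' j(3)] by blast
  then have "{J. op_alg.nontrivial_closed_subideal_in (G j) J} \<lesssim> {N. subspace N \<and> N \<subseteq> power_span S j k}"
    by (meson image_lepoll lepoll_trans subset_imp_lepoll)
  also have "\<dots> \<lesssim> (UNIV :: real set)"
    unfolding power_span_def by (rule subspaces_lepoll_real) simp
  finally show "{J. op_alg.nontrivial_closed_subideal_in (G j) J} \<lesssim> (UNIV :: real set)" .
next
  define v where "v t = S ^\<^sub>L (k - 2) + t *\<^sub>R (S ^\<^sub>L (k - 1))" for t :: real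
  have j': "j \<le> k - 1" using j by simp
  have vP: "v t \<in> power_span S j k" for t
    unfolding v_def using j
    by (intro subspace_add subspace_scale subspace_power_span op_pow_in_power_span) auto
  then have NP: "span {v t} \<subseteq> power_span S j k" for t
    using span_minimal[of "{v t}"] subspace_power_span by blast
  have v_eq: "c = 1 \<and> t = s" if "v t = c *\<^sub>R v s" for c t s
  proof -
    have "(1 - c) *\<^sub>R (S ^\<^sub>L (k - 2)) + (t - c * s) *\<^sub>R (S ^\<^sub>L (k - 1)) = v t - c *\<^sub>R v s"
      unfolding v_def by (simp add: algebra_simps)
    also have "\<dots> = 0" using that by simp
    finally have "1 - c = 0" "t - c * s = 0" by (rule top_powers_independent)+
    then show ?thesis by simp
  qed
  have v0: "v t \<noteq> 0" for t using v_eq[of t 0 0] by auto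
  have top: "S ^\<^sub>L (k - 1) \<notin> span {v t}" for t
  proof
    assume "S ^\<^sub>L (k - 1) \<in> span {v t}"
    then obtain c where c: "S ^\<^sub>L (k - 1) = c *\<^sub>R v t" unfolding span_singleton by blast
    have "c *\<^sub>R (S ^\<^sub>L (k - 2)) + (c * t - 1) *\<^sub>R (S ^\<^sub>L (k - 1)) = c *\<^sub>R v t - S ^\<^sub>L (k - 1)"
      unfolding v_def by (simp add: algebra_simps)
    also have "\<dots> = 0" using c by simp
    finally have "c = 0" "c * t - 1 = 0" by (rule top_powers_independent)+
    then show False by simp
  qed
  have mem: "op_alg.nontrivial_closed_subideal_in (G j) (span {v t} + \<K>)" for t
  proof (rule nontrivial_subideal_plus_compact[OF j(1) j' j(3) subspace_span _ NP])
    show "span {v t} \<noteq> {0}" using v0 span_base[of "v t" "{v t}"] by blast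
    show "\<forall>r\<in>{j..k - 1}. span {v t} \<noteq> power_span S r k"
    proof
      fix r assume "r \<in> {j..k - 1}"
      then have "S ^\<^sub>L (k - 1) \<in> power_span S r k" by (intro op_pow_in_power_span) auto
      then show "span {v t} \<noteq> power_span S r k" using top by blast
    qed
  qed
  have "inj (\<lambda>t. span {v t} + \<K>)"
  proof (rule injI)
    fix t s assume "span {v t} + \<K> = span {v s} + \<K>"
    then have "span {v t} = span {v s}"
      by (rule plus_compact_inject[OF _ subspace_span subspace_span NP NP j(1)])
    then have "v t \<in> span {v s}" using span_base[of "v t" "{v t}"] by simp
    then show "t = s" using v_eq unfolding span_singleton by blast
  qed
  then show "(UNIV :: real set) \<lesssim> {J. op_alg.nontrivial_closed_subideal_in (G j) J}"
    unfolding lepoll_def using mem by blast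
qed

end

theorem theorem2p3:
  fixes S :: "'a::banach \<Rightarrow>\<^sub>L 'a" and k :: nat
  assumes "tarbard_space k S"
  shows "(k = 2 \<or> k = 3 \<longrightarrow>
           \<not> (\<exists>J :: ('a \<Rightarrow>\<^sub>L 'a) set. op_alg.nontrivial_closed_subideal J)) \<and>
         (k \<ge> 4 \<longrightarrow> (\<forall>j::nat. real k / 2 \<le> real j \<and> j \<le> k - 2 \<longrightarrow>
           {J. op_alg.nontrivial_closed_subideal_in (op_alg.generated_closed_ideal (S ^\<^sub>L j)) J} =
             {N + \<K> | N. subspace N \<and> N \<noteq> {0} \<and> N \<subseteq> power_span S j k \<and>
                        (\<forall>r\<in>{j..k - 1}. N \<noteq> power_span S r k)} \<and>
           {J. op_alg.nontrivial_closed_subideal_in (op_alg.generated_closed_ideal (S ^\<^sub>L j)) J}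
             \<approx> (UNIV :: real set)))"
proof -
  interpret tarbard S k using assms by (rule tarbard.intro)
  show ?thesis
  proof (intro conjI impI allI)
    assume "k = 2 \<or> k = 3"
    then show "\<not> (\<exists>J :: ('a \<Rightarrow>\<^sub>L 'a) set. op_alg.nontrivial_closed_subideal J)"
      using no_nontrivial_subideals by simp
  next
    fix j :: nat
    assume "k \<ge> 4" and "real k / 2 \<le> real j \<and> j \<le> k - 2"
    then have j: "1 \<le> j" "j \<le> k - 1" "k \<le> 2 * j" "j \<le> k - 2" by linarith+
    show "{J. op_alg.nontrivial_closed_subideal_in (G j) J} =
        {N + \<K> | N. subspace N \<and> N \<noteq> {0} \<and> N \<subseteq> power_span S j k \<and>
          (\<forall>r\<in>{j..k - 1}. N \<noteq> power_span S r k)}"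
      by (rule nontrivial_subideals_eq[OF j(1-3)])
    show "{J. op_alg.nontrivial_closed_subideal_in (G j) J} \<approx> (UNIV :: real set)"
      by (rule nontrivial_subideals_continuum[OF j(1,4,3)])
  qed
qed

end
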